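(* Let $I=\{1,\dots,n\}$, let $A$ be a finite set, and let $G$ be a strategic game with player set $I$, common action set $A$ and payoff functions $\pi_i:A^I\to\mathbb{R}$ ($i\in I$). The following are equivalent: (1) $G$ is self-symmetric: for all $i,j\in I$ and all $\mathbf{a},\mathbf{b}\in A^I$, if $\#\mathbf{a}=\#\mathbf{b}$ then $\pi_i(\mathbf{a})=\pi_j(\mathbf{b})$; (2) $G$ is symmetric in the sense of Dasgupta and Maskin: for every permutation $\sigma$ of $I$, every $\mathbf{a}=(a_1,\dots,a_n)\in A^I$ and every $i\in I$, $\pi_i(a_1,\dots,a_n)=\pi_{\sigma(i)}(a_{\sigma(1)},\dots,a_{\sigma(n)})$.
   Context: A profile is an element $\mathbf{a}=(a_1,\dots,a_n)\in A^I$, where $a_i$ is the action chosen by player $i$. The commutative image of $\mathbf{a}$ is $\#\mathbf{a}=(\#(a,\mathbf{a}))_{a\in A}$, where $\#(a,\mathbf{a})=|\{i\in I:a_i=a\}|$ is the number of players playing action $a$ in $\mathbf{a}$.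
   Formalization: The case n = 2 with |A| ≥ 2 is excluded, since there the equivalence is false: with π_i(a) = 1 if a_i = x and 0 otherwise, (2) holds but π_1(x,y) ≠ π_1(y,x), so (1) fails; all other n and finite A are covered. *)

theory Defs
  imports Complex_Main "HOL-Library.FuncSet" "HOL-Combinatorics.Permutations"
begin

text \<open>
  A strategic game with player set \<open>I\<close> and common action set \<open>A\<close> is given by its payoff
  functions \<open>\<pi> i\<close>, \<open>i \<in> I\<close>; only their values on profiles matter.
\<close>

definition profiles :: "'i set \<Rightarrow> 'a set \<Rightarrow> ('i \<Rightarrow> 'a) set" where
  "profiles I A = (I \<rightarrow>\<^sub>E A)"

definition commutative_image :: "'i set \<Rightarrow> 'a set \<Rightarrow> ('i \<Rightarrow> 'a) \<Rightarrow> 'a \<Rightarrow> nat" where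
  "commutative_image I A a = (\<lambda>x\<in>A. card {i \<in> I. a i = x})"

definition self_symmetric ::
  "'i set \<Rightarrow> 'a set \<Rightarrow> ('i \<Rightarrow> ('i \<Rightarrow> 'a) \<Rightarrow> real) \<Rightarrow> bool" where
  "self_symmetric I A \<pi> \<longleftrightarrow>
     (\<forall>i\<in>I. \<forall>j\<in>I. \<forall>a\<in>profiles I A. \<forall>b\<in>profiles I A.
        commutative_image I A a = commutative_image I A b \<longrightarrow> \<pi> i a = \<pi> j b)"

text \<open>
  The profile \<open>a \<circ> \<sigma>\<close> is \<open>(a\<^bsub>\<sigma>(1)\<^esub>, \<dots>, a\<^bsub>\<sigma>(n)\<^esub>)\<close>. It is again extensional, since a permutation of
  \<open>I\<close> fixes every point outside \<open>I\<close>. Note that the payoff index on the right is \<open>\<sigma> i\<close>, not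
  \<open>inv \<sigma> i\<close>: player \<open>\<sigma> i\<close> plays \<open>a (\<sigma> (\<sigma> i))\<close> in \<open>a \<circ> \<sigma>\<close>.
\<close>

definition dasgupta_maskin_symmetric ::
  "'i set \<Rightarrow> 'a set \<Rightarrow> ('i \<Rightarrow> ('i \<Rightarrow> 'a) \<Rightarrow> real) \<Rightarrow> bool" where
  "dasgupta_maskin_symmetric I A \<pi> \<longleftrightarrow>
     (\<forall>\<sigma>. \<sigma> permutes I \<longrightarrow>
        (\<forall>a\<in>profiles I A. \<forall>i\<in>I. \<pi> i a = \<pi> (\<sigma> i) (a \<circ> \<sigma>)))"

lemma comp_permutes_in_profiles:
  assumes "\<sigma> permutes I" and "a \<in> profiles I A"
  shows "a \<circ> \<sigma> \<in> profiles I A"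
  using assms by (auto simp: profiles_def PiE_iff extensional_def permutes_in_image permutes_not_in)

text \<open>
  The two symmetry notions differ for two players with at least two actions: the permutations of
  a two-element set are involutions, so in that case the Dasgupta--Maskin condition is only the
  usual symmetry \<open>\<pi>\<^sub>1(a, b) = \<pi>\<^sub>2(b, a)\<close> of a two-player game.
\<close>

lemma two_player_counterexample:
  assumes "card A \<ge> 2"
  obtains \<pi> :: "nat \<Rightarrow> (nat \<Rightarrow> 'a) \<Rightarrow> real"
  where "dasgupta_maskin_symmetric {1..2} A \<pi>" and "\<not> self_symmetric {1..2} A \<pi>"
proof -
  obtain x y where xy: "x \<in> A" "y \<in> A" "x \<noteq> y"
    using assms by (metis One_nat_def card_le_Suc0_iff_eq card.infinite not_less_eq_eq
        numeral_2_eq_2 zero_le)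
  define \<pi> :: "nat \<Rightarrow> (nat \<Rightarrow> 'a) \<Rightarrow> real" where "\<pi> i a = (if a i = x then 1 else 0)" for i a
  have I: "{1..2} = {1, 2::nat}" by auto
  have invol: "\<sigma> (\<sigma> i) = i" if "\<sigma> permutes {1, 2}" "i \<in> {1, 2}" for \<sigma> and i :: nat
  proof -
    have "\<sigma> 1 \<in> {1, 2}" "\<sigma> 2 \<in> {1, 2}" "\<sigma> 1 \<noteq> \<sigma> 2"
      using that(1) permutes_in_image[OF that(1)] permutes_inj[OF that(1)]
      by (auto dest: injD)
    with that(2) show ?thesis by auto
  qed
  have 1: "dasgupta_maskin_symmetric {1..2} A \<pi>"
    unfolding dasgupta_maskin_symmetric_def I \<pi>_def
    by (intro allI impI ballI) (simp only: o_apply invol)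
  define a b :: "nat \<Rightarrow> 'a"
    where "a = (\<lambda>i\<in>{1..2}. if i = 1 then x else y)"
      and "b = (\<lambda>i\<in>{1..2}. if i = 1 then y else x)"
  have ab: "a \<in> profiles {1..2} A" "b \<in> profiles {1..2} A"
    using xy by (auto simp: profiles_def a_def b_def)
  have "card {i \<in> {1..2}. a i = z} = card {i \<in> {1..2}. b i = z}" for z
  proof -
    have "{i \<in> {1..2}. a i = z} = (if z = x then {1} else if z = y then {2} else {})"
      "{i \<in> {1..2}. b i = z} = (if z = x then {2} else if z = y then {1} else {})"
      using xy(3) unfolding I by (auto simp: a_def b_def)
    thus ?thesis by simp
  qed
  hence "commutative_image {1..2} A a = commutative_image {1..2} A b"
    by (simp add: commutative_image_def)
  moreover have "\<pi> 1 a \<noteq> \<pi> 1 b"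
    using xy(3) by (simp add: \<pi>_def a_def b_def)
  ultimately have 2: "\<not> self_symmetric {1..2} A \<pi>"
    using ab unfolding self_symmetric_def by fastforce
  show ?thesis using that 1 2 by blast
qed

end

theory Submission
  imports Defs
begin

text \<open>
  Call two profiles rearrangements of each other if one is the other composed with a permutation
  of the players. Two profiles have the same commutative image exactly when they are
  rearrangements (\<open>commutative_image_comp_permutes\<close>, \<open>commutative_image_eq_imp_rearrangement\<close>), so
  self-symmetry says that a payoff depends neither on the player nor on the arrangement of the
  profile. This immediately gives the Dasgupta--Maskin condition.

  For the converse, the point is that the Dasgupta--Maskin condition combines a left action on
  players with a right action on profiles, \<open>a \<mapsto> a \<circ> \<sigma>\<close>. Applying first \<open>\<sigma>\<close> and then \<open>\<tau>\<close> moves the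
  profile to \<open>a \<circ> \<sigma> \<circ> \<tau>\<close> and player \<open>i\<close> to \<open>\<tau> (\<sigma> i)\<close>, whereas applying \<open>\<sigma> \<circ> \<tau>\<close> at once gives the
  same profile but moves player \<open>i\<close> to \<open>\<sigma> (\<tau> i)\<close>. Hence the players \<open>\<tau> (\<sigma> i)\<close> and \<open>\<sigma> (\<tau> i)\<close> have
  equal payoffs at every profile (\<open>payoff_eq_of_commuted_permutations\<close>). Given three players,
  non-commuting transpositions make these two players an arbitrary pair, so all payoff functions agree on
  profiles, and the condition then becomes invariance under rearrangement. Two players do not
  leave room for non-commuting permutations; with at most one action, however, there is at most
  one profile, and a single transposition already exchanges the two payoffs.
\<close>

lemma commutative_image_comp_permutes:
  assumes "\<sigma> permutes I"
  shows "commutative_image I A (a \<circ> \<sigma>) = commutative_image I A a"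
proof -
  have "card {i \<in> I. (a \<circ> \<sigma>) i = x} = card {i \<in> I. a i = x}" for x
  proof -
    have "\<sigma> ` {i \<in> I. (a \<circ> \<sigma>) i = x} = {i \<in> I. a i = x}"
    proof (intro equalityI subsetI)
      fix i assume "i \<in> {i \<in> I. a i = x}"
      moreover obtain j where "i = \<sigma> j"
        using permutes_surj[OF assms] by (metis surjD)
      ultimately show "i \<in> \<sigma> ` {i \<in> I. (a \<circ> \<sigma>) i = x}"
        using permutes_in_image[OF assms] by auto
    qed (use permutes_in_image[OF assms] in auto)
    thus ?thesis
      using card_image[OF inj_on_subset[OF permutes_inj[OF assms] subset_UNIV]] by metis
  qed
  thus ?thesis
    by (simp add: commutative_image_def)
qed

text \<open>
  A profile seen as a multiset of actions is determined by its commutative image, and functions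
  with the same multiset of values on a finite set differ by a permutation of that set.
\<close>

lemma commutative_image_eq_imp_rearrangement:
  assumes "finite I" and a: "a \<in> profiles I A" and b: "b \<in> profiles I A"
    and eq: "commutative_image I A a = commutative_image I A b"
  obtains \<sigma> where "\<sigma> permutes I" and "b = a \<circ> \<sigma>"
proof -
  have card_eq: "card {i \<in> I. a i = x} = card {i \<in> I. b i = x}" for x
  proof (cases "x \<in> A")
    case True
    then show ?thesis
      using fun_cong[OF eq, of x] by (simp add: commutative_image_def)
  next
    case False
    then have "{i \<in> I. a i = x} = {}" "{i \<in> I. b i = x} = {}"
      using a b by (auto simp: profiles_def)
    then show ?thesis by (simp only:)
  qed
  have "image_mset b (mset_set I) = image_mset a (mset_set I)"
  proof (rule multiset_eqI)
    fix x
    have "{i \<in> I. x = c i} = {i \<in> I. c i = x}" for c :: "'a \<Rightarrow> 'b"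
      by auto
    then show "count (image_mset b (mset_set I)) x = count (image_mset a (mset_set I)) x"
      using \<open>finite I\<close> card_eq[of x] by (simp add: count_image_mset')
  qed
  then obtain \<sigma> where \<sigma>: "\<sigma> permutes I" "\<forall>i\<in>I. b i = a (\<sigma> i)"
    using image_mset_eq_implies_permutes[OF \<open>finite I\<close>] by metis
  have "a \<circ> \<sigma> \<in> I \<rightarrow>\<^sub>E A"
    using comp_permutes_in_profiles[OF \<sigma>(1) a] by (simp add: profiles_def)
  then have "b = a \<circ> \<sigma>"
    using b \<sigma>(2) by (intro PiE_ext[of b I "\<lambda>_. A"]) (auto simp: profiles_def)
  with \<sigma>(1) show thesis by (rule that)
qed

lemma self_symmetric_imp_dasgupta_maskin_symmetric:
  assumes "self_symmetric I A \<pi>"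
  shows "dasgupta_maskin_symmetric I A \<pi>"
  unfolding dasgupta_maskin_symmetric_def
proof (intro allI impI ballI)
  fix \<sigma> a i
  assume "\<sigma> permutes I" "a \<in> profiles I A" "i \<in> I"
  then show "\<pi> i a = \<pi> (\<sigma> i) (a \<circ> \<sigma>)"
    using assms comp_permutes_in_profiles commutative_image_comp_permutes[of \<sigma> I A a]
      permutes_in_image[of \<sigma> I i]
    unfolding self_symmetric_def by metis
qed

text \<open>
  The profile \<open>b\<close> is reached from \<open>b \<circ> inv (\<sigma> \<circ> \<tau>)\<close> both by \<open>\<sigma>\<close> followed by \<open>\<tau>\<close> and by the single
  permutation \<open>\<sigma> \<circ> \<tau>\<close>, and the two routes relabel player \<open>i\<close> in opposite orders.
\<close>

lemma payoff_eq_of_commuted_permutations: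
  assumes dm: "dasgupta_maskin_symmetric I A \<pi>"
    and \<sigma>: "\<sigma> permutes I" and \<tau>: "\<tau> permutes I"
    and b: "b \<in> profiles I A" and i: "i \<in> I"
  shows "\<pi> (\<tau> (\<sigma> i)) b = \<pi> (\<sigma> (\<tau> i)) b"
proof -
  have \<sigma>\<tau>: "\<sigma> \<circ> \<tau> permutes I"
    using \<sigma> \<tau> by (simp add: permutes_compose)
  define a where "a = b \<circ> inv (\<sigma> \<circ> \<tau>)"
  have a: "a \<in> profiles I A"
    unfolding a_def using b permutes_inv[OF \<sigma>\<tau>] by (rule comp_permutes_in_profiles[rotated])
  have ab: "a \<circ> \<sigma> \<circ> \<tau> = b"
    unfolding a_def using permutes_inv_o(2)[OF \<sigma>\<tau>] by (metis comp_assoc comp_id)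
  have "\<pi> (\<tau> (\<sigma> i)) (a \<circ> \<sigma> \<circ> \<tau>) = \<pi> (\<sigma> i) (a \<circ> \<sigma>)"
    using dm \<tau> comp_permutes_in_profiles[OF \<sigma> a] permutes_in_image[OF \<sigma>] i
    unfolding dasgupta_maskin_symmetric_def by metis
  also have "\<dots> = \<pi> i a"
    using dm \<sigma> a i unfolding dasgupta_maskin_symmetric_def by metis
  also have "\<dots> = \<pi> ((\<sigma> \<circ> \<tau>) i) (a \<circ> (\<sigma> \<circ> \<tau>))"
    using dm \<sigma>\<tau> a i unfolding dasgupta_maskin_symmetric_def by metis
  finally show ?thesis
    using ab by (simp add: comp_assoc)
qed

text \<open>
  Moving a third player \<open>i\<close> by the transpositions \<open>(i j)\<close> and \<open>(i k)\<close> in either order yields \<open>j\<close>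
  in one case and \<open>k\<close> in the other.
\<close>

lemma dasgupta_maskin_symmetric_payoff_eq_third_player:
  assumes "dasgupta_maskin_symmetric I A \<pi>" and "b \<in> profiles I A"
    and "i \<in> I" "j \<in> I" "k \<in> I" and "i \<noteq> j" "i \<noteq> k" "j \<noteq> k"
  shows "\<pi> j b = \<pi> k b"
proof -
  have "transpose i j permutes I" "transpose i k permutes I"
    using assms by (simp_all add: permutes_swap_id)
  from payoff_eq_of_commuted_permutations[OF assms(1) this assms(2,3)]
  show ?thesis
    using assms(6-8) by (simp add: transpose_def)
qed

lemma profile_unique:
  assumes "finite A" "card A \<le> 1" "a \<in> profiles I A" "b \<in> profiles I A"
  shows "a = b"
proof (rule PiE_ext[of a I "\<lambda>_. A"])
  fix i assume "i \<in> I"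
  then have "a i \<in> A" "b i \<in> A"
    using assms(3,4) by (auto simp: profiles_def)
  then show "a i = b i"
    using assms(1,2) card_le_Suc0_iff_eq[of A] by simp
qed (use assms in \<open>simp_all add: profiles_def\<close>)

lemma dasgupta_maskin_symmetric_payoff_eq:
  assumes "finite I" "finite A" and small: "card I \<noteq> 2 \<or> card A \<le> 1"
    and dm: "dasgupta_maskin_symmetric I A \<pi>" and b: "b \<in> profiles I A"
    and j: "j \<in> I" and k: "k \<in> I"
  shows "\<pi> j b = \<pi> k b"
proof (cases "j = k")
  case False
  show ?thesis
  proof (cases "card A \<le> 1")
    case True
    have \<sigma>: "transpose j k permutes I"
      using j k by (simp add: permutes_swap_id)
    have "\<pi> j b = \<pi> (transpose j k j) (b \<circ> transpose j k)"
      using dm \<sigma> b j unfolding dasgupta_maskin_symmetric_def by blast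
    also have "b \<circ> transpose j k = b"
      using profile_unique[OF \<open>finite A\<close> True] comp_permutes_in_profiles[OF \<sigma> b] b by blast
    finally show ?thesis by simp
  next
    case False
    have "I \<noteq> {j, k}"
      using small False \<open>j \<noteq> k\<close> by auto
    then obtain i where "i \<in> I" "i \<noteq> j" "i \<noteq> k"
      using j k by blast
    then show ?thesis
      using dasgupta_maskin_symmetric_payoff_eq_third_player[OF dm b _ j k] \<open>j \<noteq> k\<close> by blast
  qed
qed simp

lemma dasgupta_maskin_symmetric_imp_self_symmetric:
  assumes "finite I" "finite A" "card I \<noteq> 2 \<or> card A \<le> 1"
    and dm: "dasgupta_maskin_symmetric I A \<pi>"
  shows "self_symmetric I A \<pi>"
  unfolding self_symmetric_def
proof (intro ballI impI)
  fix i j a b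
  assume i: "i \<in> I" and j: "j \<in> I" and a: "a \<in> profiles I A" and b: "b \<in> profiles I A"
    and "commutative_image I A a = commutative_image I A b"
  then obtain \<sigma> where \<sigma>: "\<sigma> permutes I" and ab: "b = a \<circ> \<sigma>"
    using commutative_image_eq_imp_rearrangement \<open>finite I\<close> by metis
  have "\<pi> i a = \<pi> (\<sigma> i) b"
    using dm \<sigma> a i unfolding dasgupta_maskin_symmetric_def ab by blast
  also have "\<dots> = \<pi> j b"
    using dasgupta_maskin_symmetric_payoff_eq[OF assms b] permutes_in_image[OF \<sigma>] i j by blast
  finally show "\<pi> i a = \<pi> j b" .
qed

theorem proposition2p15:
  fixes n :: nat
    and A :: "'a set"
    and \<pi> :: "nat \<Rightarrow> (nat \<Rightarrow> 'a) \<Rightarrow> real"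
  assumes "finite A"
    and "n \<noteq> 2 \<or> card A \<le> 1"
  shows "self_symmetric {1..n} A \<pi> \<longleftrightarrow> dasgupta_maskin_symmetric {1..n} A \<pi>"
  using self_symmetric_imp_dasgupta_maskin_symmetric
    dasgupta_maskin_symmetric_imp_self_symmetric[of "{1..n}" A \<pi>] assms by auto

end
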